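(* Let $G$ and $H$ be two connected non-trivial graphs. Then $\Phi_c(G \Box H) = \min\{\Phi_c(G), \Phi_c(H)\}$ and $\Theta_c(G \Box H) = \min\{\Theta_c(G), \Theta_c(H)\}$.
   Context: Graphs are finite, simple and undirected; non-trivial means having at least two vertices. A set $S \subseteq V(G)$ is $\Delta$-convex if there is no vertex $w \in V(G)\setminus S$ that forms a triangle (three pairwise adjacent vertices) with two vertices of $S$. A $\Delta$-convex $p$-cover of $G$ is a family of $p$ $\Delta$-convex sets whose union is $V(G)$ and such that every member has an element belonging to no other member; a $\Delta$-convex $p$-partition is a $\Delta$-convex $p$-cover whose members are pairwise disjoint. For a graph $G$ of order at least $2$, the $\Delta$-cover number $\Phi_c(G)$ (respectively, the $\Delta$-partition number $\Theta_c(G)$) is the minimum $p \ge 2$ such that $G$ admits a $\Delta$-convex $p$-cover (respectively, $\Delta$-convex $p$-partition). The Cartesian product $G \Box H$ has vertex set $V(G)\times V(H)$, and two vertices are adjacent if they are adjacent in one coordinate and equal in the other. *)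

theory Defs
  imports "Graph_Theory.Graph_Theory"
begin

text \<open>
  A finite simple undirected graph is a record \<open>G :: 'a pair_pre_digraph\<close> with \<open>pair_graph G\<close>:
  an undirected edge is represented by its two opposite arcs.
\<close>

definition cartesian_product ::
  "'a pair_pre_digraph \<Rightarrow> 'b pair_pre_digraph \<Rightarrow> ('a \<times> 'b) pair_pre_digraph"
  where
  "cartesian_product G H =
    \<lparr> pverts = pverts G \<times> pverts H,
      parcs = {((g, h), (g', h')) | g h g' h'.
        g \<in> pverts G \<and> g' \<in> pverts G \<and> h \<in> pverts H \<and> h' \<in> pverts H \<and>
        ((g, g') \<in> parcs G \<and> h = h' \<or> g = g' \<and> (h, h') \<in> parcs H)} \<rparr>"

lemma pair_graph_cartesian_product:
  assumes "pair_graph G" and "pair_graph H"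
  shows "pair_graph (cartesian_product G H)"
proof -
  interpret G: pair_graph G by fact
  interpret H: pair_graph H by fact
  let ?P = "cartesian_product G H"
  have sub: "parcs ?P \<subseteq> pverts ?P \<times> pverts ?P"
    by (auto simp: cartesian_product_def)
  have fin: "finite (pverts ?P)"
    by (simp add: cartesian_product_def)
  have "sym (parcs ?P)"
    by (auto simp: cartesian_product_def sym_def intro: G.arcs_symmetric H.arcs_symmetric)
  moreover have "finite (parcs ?P)"
    using sub fin by (meson finite_SigmaI finite_subset)
  moreover have "\<And>e. e \<in> parcs ?P \<Longrightarrow> fst e \<noteq> snd e"
    by (auto simp: cartesian_product_def dest: G.no_loops' H.no_loops')
  ultimately show ?thesis
    using sub fin by unfold_locales (auto simp: symmetric_def)
qed

definition triangle :: "'a pair_pre_digraph \<Rightarrow> 'a \<Rightarrow> 'a \<Rightarrow> 'a \<Rightarrow> bool"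
  where
  "triangle G u v w \<longleftrightarrow> (u, v) \<in> parcs G \<and> (v, w) \<in> parcs G \<and> (u, w) \<in> parcs G"

definition delta_convex :: "'a pair_pre_digraph \<Rightarrow> 'a set \<Rightarrow> bool"
  where
  "delta_convex G S \<longleftrightarrow>
    S \<subseteq> pverts G \<and> \<not> (\<exists>w \<in> pverts G - S. \<exists>u \<in> S. \<exists>v \<in> S. triangle G u v w)"

text \<open>
  A family of sets is modelled as a set of sets: the members of an indexed family are
  automatically distinct, since each of them has an element belonging to no other member.
\<close>

definition delta_convex_cover :: "'a pair_pre_digraph \<Rightarrow> nat \<Rightarrow> 'a set set \<Rightarrow> bool"
  where
  "delta_convex_cover G p C \<longleftrightarrow>
    finite C \<and> card C = p \<and> (\<forall>S \<in> C. delta_convex G S) \<and> \<Union>C = pverts G \<and>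
    (\<forall>S \<in> C. \<exists>x \<in> S. \<forall>T \<in> C. T \<noteq> S \<longrightarrow> x \<notin> T)"

definition delta_convex_partition :: "'a pair_pre_digraph \<Rightarrow> nat \<Rightarrow> 'a set set \<Rightarrow> bool"
  where
  "delta_convex_partition G p C \<longleftrightarrow> delta_convex_cover G p C \<and> pairwise disjnt C"

definition delta_cover_number :: "'a pair_pre_digraph \<Rightarrow> nat"
  where
  "delta_cover_number G = (LEAST p. 2 \<le> p \<and> (\<exists>C. delta_convex_cover G p C))"

definition delta_partition_number :: "'a pair_pre_digraph \<Rightarrow> nat"
  where
  "delta_partition_number G = (LEAST p. 2 \<le> p \<and> (\<exists>C. delta_convex_partition G p C))"

text \<open>
  The singletons witness that the two minima exist for every graph of order at least two.
\<close>

lemma delta_convex_partition_singletons: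
  assumes "pair_graph G"
  shows "delta_convex_partition G (card (pverts G)) ((\<lambda>v. {v}) ` pverts G)"
proof -
  interpret G: pair_graph G by fact
  have "card ((\<lambda>v. {v}) ` pverts G) = card (pverts G)"
    by (intro card_image) (auto simp: inj_on_def)
  moreover have "delta_convex G {v}" if "v \<in> pverts G" for v
    using that by (auto simp: delta_convex_def triangle_def dest: G.no_loops')
  ultimately show ?thesis
    by (auto simp: delta_convex_partition_def delta_convex_cover_def pairwise_def disjnt_def)
qed

end

theory Submission
  imports Defs
begin

text \<open>
  A triangle of \<open>G \<box> H\<close> lies in a single layer, so the product of a \<open>\<Delta>\<close>-convex set of one
  factor with the whole other factor is \<open>\<Delta>\<close>-convex, and covers of a factor lift to the product.
  Conversely, let \<open>C\<close> cover the product. If some \<open>G\<close>-layer lies in no member of \<open>C\<close>, the traces of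
  \<open>C\<close> on it cover \<open>G\<close> by proper \<open>\<Delta>\<close>-convex sets. Otherwise every \<open>G\<close>-layer lies in a member of
  \<open>C\<close>, and the sets \<open>{h. V(G) \<times> {h} \<subseteq> S}\<close> for \<open>S \<in> C\<close> cover \<open>H\<close>; they are \<open>\<Delta>\<close>-convex as
  intersections of traces on \<open>H\<close>-layers, and proper because \<open>S\<close> misses the private vertex of another
  member. In both cases a minimal subcover is the required one.
\<close>

section \<open>Adjacency in the product and basic rules for \<Delta>-convexity\<close>

lemma pverts_cartesian_product [simp]:
  "pverts (cartesian_product G H) = pverts G \<times> pverts H"
  by (simp add: cartesian_product_def)

lemma parcs_cartesian_product:
  "((g, h), (g', h')) \<in> parcs (cartesian_product G H) \<longleftrightarrow>
    g \<in> pverts G \<and> g' \<in> pverts G \<and> h \<in> pverts H \<and> h' \<in> pverts H \<and>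
    ((g, g') \<in> parcs G \<and> h = h' \<or> g = g' \<and> (h, h') \<in> parcs H)"
  by (simp add: cartesian_product_def)

lemma delta_convexD:
  assumes "delta_convex G S" "u \<in> S" "v \<in> S" "triangle G u v w" "w \<in> pverts G"
  shows "w \<in> S"
  using assms by (auto simp: delta_convex_def)

lemma delta_convexI:
  assumes "S \<subseteq> pverts G"
    "\<And>u v w. u \<in> S \<Longrightarrow> v \<in> S \<Longrightarrow> triangle G u v w \<Longrightarrow> w \<in> pverts G \<Longrightarrow> w \<in> S"
  shows "delta_convex G S"
  unfolding delta_convex_def
proof (intro conjI notI)
  assume "\<exists>w\<in>pverts G - S. \<exists>u\<in>S. \<exists>v\<in>S. triangle G u v w"
  then show False
    by (elim bexE DiffE) (rule notE, assumption, rule assms(2))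
qed (rule assms(1))

lemma delta_convex_subset: "delta_convex G S \<Longrightarrow> S \<subseteq> pverts G"
  by (simp add: delta_convex_def)

text \<open>A closure property survives intersection; \<open>I \<noteq> {}\<close> keeps the
  intersection inside \<open>pverts G\<close> instead of being \<open>UNIV\<close>.\<close>

lemma delta_convex_Inter:
  assumes convex: "\<And>i. i \<in> I \<Longrightarrow> delta_convex G (S i)" and "I \<noteq> {}"
  shows "delta_convex G (\<Inter>i\<in>I. S i)"
proof (rule delta_convexI)
  obtain i where i: "i \<in> I" using assms(2) by blast
  show "(\<Inter>i\<in>I. S i) \<subseteq> pverts G"
    using i delta_convex_subset[OF convex[OF i]] by (rule INF_lower2)
  fix u v w
  assume *: "u \<in> (\<Inter>i\<in>I. S i)" "v \<in> (\<Inter>i\<in>I. S i)" "triangle G u v w" "w \<in> pverts G"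
  show "w \<in> (\<Inter>i\<in>I. S i)"
  proof (rule INT_I)
    fix i assume i: "i \<in> I"
    show "w \<in> S i"
      using convex[OF i] INT_D[OF *(1) i] INT_D[OF *(2) i] *(3,4) by (rule delta_convexD)
  qed
qed

section \<open>\<Delta>-convex sets of the product versus those of the factors\<close>

text \<open>If \<open>w\<close> has its first coordinate outside \<open>S\<close>, it differs there
  from \<open>u\<close> and \<open>v\<close>, so both edges at \<open>w\<close> are
  \<open>G\<close>-edges and all three second coordinates agree. As \<open>H\<close> has no loops,
  the edge \<open>uv\<close> is a \<open>G\<close>-edge too, and the triangle projects to one of
  \<open>G\<close>, against the convexity of \<open>S\<close>.\<close>

lemma delta_convex_times_verts:
  assumes "pair_graph G" "pair_graph H" "delta_convex G S"
  shows "delta_convex (cartesian_product G H) (S \<times> pverts H)"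
proof (rule delta_convexI)
  interpret G: pair_graph G by fact
  interpret H: pair_graph H by fact
  show "S \<times> pverts H \<subseteq> pverts (cartesian_product G H)"
    using delta_convex_subset[OF assms(3)] by auto
  fix u v w
  assume *: "u \<in> S \<times> pverts H" "v \<in> S \<times> pverts H"
    "triangle (cartesian_product G H) u v w" "w \<in> pverts (cartesian_product G H)"
  have "fst w \<in> S"
  proof (rule ccontr)
    assume "fst w \<notin> S"
    with * have "triangle G (fst u) (fst v) (fst w)"
      by (cases u; cases v; cases w)
        (auto simp: triangle_def parcs_cartesian_product dest: H.no_loops')
    then have "fst w \<in> S"
      using delta_convexD[OF assms(3), of "fst u" "fst v" "fst w"] * by (auto simp: mem_Times_iff)
    with \<open>fst w \<notin> S\<close> show False ..
  qed
  with *(4) show "w \<in> S \<times> pverts H" by (cases w) simp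
qed

lemma delta_convex_verts_times:
  assumes "pair_graph G" "pair_graph H" "delta_convex H S"
  shows "delta_convex (cartesian_product G H) (pverts G \<times> S)"
proof (rule delta_convexI)
  interpret G: pair_graph G by fact
  interpret H: pair_graph H by fact
  show "pverts G \<times> S \<subseteq> pverts (cartesian_product G H)"
    using delta_convex_subset[OF assms(3)] by auto
  fix u v w
  assume *: "u \<in> pverts G \<times> S" "v \<in> pverts G \<times> S"
    "triangle (cartesian_product G H) u v w" "w \<in> pverts (cartesian_product G H)"
  have "snd w \<in> S"
  proof (rule ccontr)
    assume "snd w \<notin> S"
    with * have "triangle H (snd u) (snd v) (snd w)"
      by (cases u; cases v; cases w)
        (auto simp: triangle_def parcs_cartesian_product dest: G.no_loops')
    then have "snd w \<in> S"
      using delta_convexD[OF assms(3), of "snd u" "snd v" "snd w"] * by (auto simp: mem_Times_iff)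
    with \<open>snd w \<notin> S\<close> show False ..
  qed
  with *(4) show "w \<in> pverts G \<times> S" by (cases w) simp
qed

text \<open>The embedding of \<open>G\<close> as the layer at \<open>h\<close> sends triangles to
  triangles.\<close>

lemma delta_convex_trace_fst:
  assumes "delta_convex (cartesian_product G H) S" "h \<in> pverts H"
  shows "delta_convex G {g. (g, h) \<in> S}"
proof (rule delta_convexI)
  show sub: "{g. (g, h) \<in> S} \<subseteq> pverts G"
    using delta_convex_subset[OF assms(1)] by auto
  fix u v w
  assume *: "u \<in> {g. (g, h) \<in> S}" "v \<in> {g. (g, h) \<in> S}" "triangle G u v w" "w \<in> pverts G"
  with sub assms(2) have "triangle (cartesian_product G H) (u, h) (v, h) (w, h)"
    by (auto simp: triangle_def parcs_cartesian_product)
  with * assms(2) show "w \<in> {g. (g, h) \<in> S}"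
    using delta_convexD[OF assms(1), of "(u, h)" "(v, h)" "(w, h)"] by simp
qed

lemma delta_convex_trace_snd:
  assumes "delta_convex (cartesian_product G H) S" "g \<in> pverts G"
  shows "delta_convex H {h. (g, h) \<in> S}"
proof (rule delta_convexI)
  show sub: "{h. (g, h) \<in> S} \<subseteq> pverts H"
    using delta_convex_subset[OF assms(1)] by auto
  fix u v w
  assume *: "u \<in> {h. (g, h) \<in> S}" "v \<in> {h. (g, h) \<in> S}" "triangle H u v w" "w \<in> pverts H"
  with sub assms(2) have "triangle (cartesian_product G H) (g, u) (g, v) (g, w)"
    by (auto simp: triangle_def parcs_cartesian_product)
  with * assms(2) show "w \<in> {h. (g, h) \<in> S}"
    using delta_convexD[OF assms(1), of "(g, u)" "(g, v)" "(g, w)"] by simp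
qed

section \<open>Lifting covers from a factor to the product\<close>

text \<open>Pulls a cover back along a surjection \<open>f\<close> on vertices, to be used with the
  two projections of the product. Surjectivity preserves both the number of members and their
  private vertices.\<close>

lemma delta_convex_cover_image:
  assumes "delta_convex_cover G p C"
    and convex: "\<And>S. S \<in> C \<Longrightarrow> delta_convex K (f -` S \<inter> pverts K)"
    and onto: "f ` pverts K = pverts G"
  shows "delta_convex_cover K p ((\<lambda>S. f -` S \<inter> pverts K) ` C)"
    and "pairwise disjnt C \<Longrightarrow> pairwise disjnt ((\<lambda>S. f -` S \<inter> pverts K) ` C)"
proof -
  let ?P = "\<lambda>S. f -` S \<inter> pverts K"
  have C: "finite C" "card C = p" "\<Union>C = pverts G"
    and priv: "\<And>S. S \<in> C \<Longrightarrow> \<exists>x\<in>S. \<forall>T\<in>C. T \<noteq> S \<longrightarrow> x \<notin> T"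
    using assms(1) by (auto simp: delta_convex_cover_def)
  have image: "f ` ?P S = S" if "S \<in> C" for S
  proof -
    have "S \<subseteq> f ` pverts K" using that C(3) onto by blast
    then show ?thesis by blast
  qed
  \<comment> \<open>The direct image under \<open>f\<close> is a left inverse of \<open>?P\<close>
    on \<open>C\<close>, so no two members are merged.\<close>
  then have "inj_on ?P C" by (rule inj_on_inverseI)
  then have "card (?P ` C) = p" using C(2) card_image by blast
  moreover have "\<exists>x\<in>?P S. \<forall>T\<in>C. ?P T \<noteq> ?P S \<longrightarrow> x \<notin> ?P T" if S: "S \<in> C" for S
  proof -
    obtain y where y: "y \<in> S" "\<forall>T\<in>C. T \<noteq> S \<longrightarrow> y \<notin> T"
      using priv S by blast
    \<comment> \<open>Any vertex above the private vertex \<open>y\<close> of \<open>S\<close> is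
      private to \<open>?P S\<close>.\<close>
    from y(1) have "y \<in> f ` ?P S" by (simp add: image[OF S])
    then obtain x where "x \<in> ?P S" "f x = y" by blast
    with y show ?thesis by blast
  qed
  moreover have "\<Union>(?P ` C) = pverts K"
    using C(3) onto by blast
  ultimately show "delta_convex_cover K p (?P ` C)"
    using C(1) convex by (auto simp: delta_convex_cover_def)
  show "pairwise disjnt (?P ` C)" if "pairwise disjnt C"
    using that by (fastforce simp: pairwise_def disjnt_def)
qed

text \<open>Carrying disjointness along as an implication lets one lift serve covers and partitions
  alike. The projection is onto because \<open>H\<close> has a vertex.\<close>

lemma delta_convex_cover_lift_fst:
  assumes "pair_graph G" "pair_graph H" "pverts H \<noteq> {}" "delta_convex_cover G p C"
  shows "\<exists>D. delta_convex_cover (cartesian_product G H) p D \<and>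
    (pairwise disjnt C \<longrightarrow> pairwise disjnt D)"
proof -
  have "delta_convex (cartesian_product G H) (fst -` S \<inter> pverts (cartesian_product G H))"
    if "S \<in> C" for S
  proof -
    have "delta_convex G S" using that assms(4) by (auto simp: delta_convex_cover_def)
    moreover from this have "fst -` S \<inter> pverts (cartesian_product G H) = S \<times> pverts H"
      by (auto simp: delta_convex_def)
    ultimately show ?thesis using delta_convex_times_verts assms(1,2) by metis
  qed
  moreover have "fst ` pverts (cartesian_product G H) = pverts G"
    using assms(3) by simp
  ultimately show ?thesis
    using delta_convex_cover_image[OF assms(4)] by metis
qed

lemma delta_convex_cover_lift_snd:
  assumes "pair_graph G" "pair_graph H" "pverts G \<noteq> {}" "delta_convex_cover H p C"
  shows "\<exists>D. delta_convex_cover (cartesian_product G H) p D \<and>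
    (pairwise disjnt C \<longrightarrow> pairwise disjnt D)"
proof -
  have "delta_convex (cartesian_product G H) (snd -` S \<inter> pverts (cartesian_product G H))"
    if "S \<in> C" for S
  proof -
    have "delta_convex H S" using that assms(4) by (auto simp: delta_convex_cover_def)
    moreover from this have "snd -` S \<inter> pverts (cartesian_product G H) = pverts G \<times> S"
      by (auto simp: delta_convex_def)
    ultimately show ?thesis using delta_convex_verts_times assms(1,2) by metis
  qed
  moreover have "snd ` pverts (cartesian_product G H) = pverts H"
    using assms(3) by simp
  ultimately show ?thesis
    using delta_convex_cover_image[OF assms(4)] by metis
qed

section \<open>From a cover of the product to a cover of a factor\<close>

text \<open>An inclusion-minimal subfamily with full union works: a member without a private vertex
  could be dropped. At least two members remain, since a single one would have to be
  \<open>pverts G\<close> itself.\<close>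

lemma exists_delta_convex_subcover:
  assumes "finite F" "\<And>S. S \<in> F \<Longrightarrow> delta_convex G S" "\<Union>F = pverts G"
    "pverts G \<notin> F" "pverts G \<noteq> {}"
  shows "\<exists>D\<subseteq>F. 2 \<le> card D \<and> delta_convex_cover G (card D) D"
proof -
  let ?A = "{D. D \<subseteq> F \<and> \<Union>D = pverts G}"
  have "finite ?A" "F \<in> ?A" using assms(1,3) by auto
  then obtain D where "D \<in> ?A" and min: "\<forall>D'\<in>?A. D' \<subseteq> D \<longrightarrow> D = D'"
    by (meson finite_has_minimal2)
  then have D: "D \<subseteq> F" "\<Union>D = pverts G" by simp_all
  have fin: "finite D" using D(1) assms(1) by (rule finite_subset)
  have "card D \<noteq> 0" using D(2) assms(5) fin by auto
  moreover have "card D \<noteq> 1"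
    using D assms(4) by (auto simp: card_1_singleton_iff)
  ultimately have "2 \<le> card D" by linarith
  moreover have "\<exists>x\<in>S. \<forall>T\<in>D. T \<noteq> S \<longrightarrow> x \<notin> T" if "S \<in> D" for S
  proof (rule ccontr)
    assume "\<not> ?thesis"
    then have "S \<subseteq> \<Union>(D - {S})" by blast
    then have "\<Union>(D - {S}) = \<Union>D" by blast
    with D have "D - {S} \<in> ?A" by auto
    from bspec[OF min this] have "D = D - {S}" by simp
    with that show False by (metis Diff_iff singletonI)
  qed
  then have "delta_convex_cover G (card D) D"
    using D fin assms(2) by (simp add: delta_convex_cover_def subset_iff)
  ultimately show ?thesis using D(1) by blast
qed

text \<open>Common end of both cases below, where \<open>f\<close> turns members of a product cover
  into subsets of a factor. Only \<open>q \<le> card C\<close> is claimed, because \<open>f\<close>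
  may merge members and the subcover may discard some.\<close>

lemma delta_convex_cover_of_image:
  assumes "finite C" "\<And>S. S \<in> C \<Longrightarrow> delta_convex K (f S)" "\<Union>(f ` C) = pverts K"
    "pverts K \<notin> f ` C" "pverts K \<noteq> {}"
    and disj: "\<And>S T. disjnt S T \<Longrightarrow> disjnt (f S) (f T)"
  shows "\<exists>q D. 2 \<le> q \<and> q \<le> card C \<and> delta_convex_cover K q D \<and>
    (pairwise disjnt C \<longrightarrow> pairwise disjnt D)"
proof -
  obtain D where D: "D \<subseteq> f ` C" "2 \<le> card D" "delta_convex_cover K (card D) D"
    using exists_delta_convex_subcover[of "f ` C" K] assms(1-5) by auto
  have "card D \<le> card C"
    using D(1) assms(1) by (meson card_image_le card_mono finite_imageI le_trans)
  moreover have "pairwise disjnt D" if "pairwise disjnt C"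
  proof -
    have "pairwise disjnt (f ` C)"
      using that disj by (fastforce simp: pairwise_def)
    then show ?thesis using D(1) by (rule pairwise_subset)
  qed
  ultimately show ?thesis using D(2,3) by blast
qed

lemma delta_convex_cover_cartesian_product_factor:
  assumes "pverts G \<noteq> {}" "pverts H \<noteq> {}"
    "2 \<le> p" "delta_convex_cover (cartesian_product G H) p C"
  shows "(\<exists>q D. 2 \<le> q \<and> q \<le> p \<and> delta_convex_cover G q D \<and>
      (pairwise disjnt C \<longrightarrow> pairwise disjnt D)) \<or>
    (\<exists>q D. 2 \<le> q \<and> q \<le> p \<and> delta_convex_cover H q D \<and>
      (pairwise disjnt C \<longrightarrow> pairwise disjnt D))"
proof -
  have C: "finite C" "card C = p" "\<Union>C = pverts G \<times> pverts H"
    and convex: "\<And>S. S \<in> C \<Longrightarrow> delta_convex (cartesian_product G H) S"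
    and priv: "\<And>S. S \<in> C \<Longrightarrow> \<exists>x\<in>S. \<forall>T\<in>C. T \<noteq> S \<longrightarrow> x \<notin> T"
    using assms(4) by (auto simp: delta_convex_cover_def)
  show ?thesis
  proof (cases "\<exists>h\<in>pverts H. \<forall>S\<in>C. \<not> pverts G \<times> {h} \<subseteq> S")
    case True
    then obtain h where h: "h \<in> pverts H" "\<And>S. S \<in> C \<Longrightarrow> \<not> pverts G \<times> {h} \<subseteq> S"
      by blast
    let ?f = "\<lambda>S. {g. (g, h) \<in> S}"
    have "\<exists>q D. 2 \<le> q \<and> q \<le> card C \<and> delta_convex_cover G q D \<and>
      (pairwise disjnt C \<longrightarrow> pairwise disjnt D)"
    proof (rule delta_convex_cover_of_image[where f = ?f])
      show "delta_convex G (?f S)" if "S \<in> C" for S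
        using convex[OF that] h(1) by (rule delta_convex_trace_fst)
      show "\<Union>(?f ` C) = pverts G"
        using C(3) h(1) by blast
      \<comment> \<open>A trace equal to \<open>pverts G\<close> would put the whole layer at
        \<open>h\<close> inside one member, against the choice of \<open>h\<close>.\<close>
      show "pverts G \<notin> ?f ` C"
        using h(2) by fastforce
    qed (use C(1) assms(1) in \<open>auto simp: disjnt_def\<close>)
    then show ?thesis using C(2) by blast
  next
    case False
    \<comment> \<open>This is the set of those \<open>h\<close> whose whole \<open>G\<close>-layer
      lies in \<open>S\<close>, written as an intersection of traces so that convexity is
      inherited.\<close>
    let ?f = "\<lambda>S. \<Inter>g\<in>pverts G. {h. (g, h) \<in> S}"
    have "\<exists>q D. 2 \<le> q \<and> q \<le> card C \<and> delta_convex_cover H q D \<and>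
      (pairwise disjnt C \<longrightarrow> pairwise disjnt D)"
    proof (rule delta_convex_cover_of_image[where f = ?f])
      show "delta_convex H (?f S)" if "S \<in> C" for S
        using convex[OF that] assms(1) by (intro delta_convex_Inter delta_convex_trace_snd)
      show "\<Union>(?f ` C) = pverts H"
      proof
        show "\<Union>(?f ` C) \<subseteq> pverts H" using C(3) assms(1) by blast
        show "pverts H \<subseteq> \<Union>(?f ` C)"
        proof
          fix h assume "h \<in> pverts H"
          with False obtain S where "S \<in> C" "pverts G \<times> {h} \<subseteq> S" by blast
          then have "h \<in> ?f S" by blast
          with \<open>S \<in> C\<close> show "h \<in> \<Union>(?f ` C)" by (rule UN_I)
        qed
      qed
      show "pverts H \<notin> ?f ` C"
      proof
        assume "pverts H \<in> ?f ` C"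
        then obtain S where S: "S \<in> C" "pverts H = ?f S" by blast
        then have full: "pverts G \<times> pverts H \<subseteq> S" by blast
        \<comment> \<open>By \<open>2 \<le> p\<close> there is a second member, whose private vertex
          cannot lie in \<open>S\<close>, although \<open>S\<close> already contains the whole
          product.\<close>
        have "C \<noteq> {S}" using C(2) assms(3) by auto
        then obtain T where T: "T \<in> C" "T \<noteq> S" using S(1) by blast
        then obtain x where "x \<in> T" "x \<notin> S" using priv[of T] S(1) by metis
        with T(1) full C(3) show False by blast
      qed
    \<comment> \<open>For disjointness: an \<open>h\<close> common to \<open>?f S\<close> and
      \<open>?f T\<close> would put its nonempty \<open>G\<close>-layer in both \<open>S\<close> and
      \<open>T\<close>.\<close>
    qed (use C(1) assms(1,2) in \<open>auto simp: disjnt_def\<close>)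
    then show ?thesis using C(2) by blast
  qed
qed

section \<open>Comparison of the minima\<close>

text \<open>Passing from \<open>P\<close> to \<open>Q\<close> or \<open>R\<close> may lower the
  number, which is enough for minima. The witnesses \<open>a\<close> and \<open>b\<close> ensure
  that every \<open>Least\<close> is attained.\<close>

lemma Least_eq_min_Least:
  fixes P Q R :: "nat \<Rightarrow> bool"
  assumes "\<And>p. P p \<Longrightarrow> \<exists>q\<le>p. Q q \<or> R q" "\<And>p. Q p \<Longrightarrow> P p" "\<And>p. R p \<Longrightarrow> P p"
    and "Q a" "R b"
  shows "Least P = min (Least Q) (Least R)"
proof (rule antisym)
  have "Q (Least Q)" "R (Least R)"
    using LeastI[of Q, OF assms(4)] LeastI[of R, OF assms(5)] by blast+
  then have "P (Least Q)" "P (Least R)"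
    using assms(2,3) by simp_all
  then show "Least P \<le> min (Least Q) (Least R)"
    by (simp add: Least_le)
  have "P (Least P)"
    using assms(2)[OF assms(4)] by (rule LeastI)
  then obtain q where "q \<le> Least P" "Q q \<or> R q"
    using assms(1) by blast
  then show "min (Least Q) (Least R) \<le> Least P"
    by (meson Least_le min.coboundedI1 min.coboundedI2 order_trans)
qed

theorem theorem12:
  fixes G :: "'a pair_pre_digraph" and H :: "'b pair_pre_digraph"
  assumes "pair_graph G" and "Digraph_Component.connected (with_proj G)"
    and "2 \<le> card (pverts G)"
    and "pair_graph H" and "Digraph_Component.connected (with_proj H)"
    and "2 \<le> card (pverts H)"
  shows "delta_cover_number (cartesian_product G H) =
      min (delta_cover_number G) (delta_cover_number H) \<and>
    delta_partition_number (cartesian_product G H) =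
      min (delta_partition_number G) (delta_partition_number H)"
proof
  have ne: "pverts G \<noteq> {}" "pverts H \<noteq> {}"
    using assms(3,6) by auto
  note lift_fst = delta_convex_cover_lift_fst[OF assms(1,4) ne(2)]
  note lift_snd = delta_convex_cover_lift_snd[OF assms(1,4) ne(1)]
  note factor = delta_convex_cover_cartesian_product_factor[OF ne]
  note singletons = delta_convex_partition_singletons[OF assms(1)]
    delta_convex_partition_singletons[OF assms(4)]
  show "delta_cover_number (cartesian_product G H) =
      min (delta_cover_number G) (delta_cover_number H)"
    unfolding delta_cover_number_def
  \<comment> \<open>The singletons of each factor supply the witnesses: as many members as vertices,
    hence at least two.\<close>
  proof (rule Least_eq_min_Least[of _ _ _ "card (pverts G)" "card (pverts H)"], goal_cases)
    case 1 then show ?case using factor by meson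
  next
    case 2 then show ?case using lift_fst by meson
  next
    case 3 then show ?case using lift_snd by meson
  next
    case 4 then show ?case using singletons(1) assms(3) delta_convex_partition_def by metis
  next
    case 5 then show ?case using singletons(2) assms(6) delta_convex_partition_def by metis
  qed
  show "delta_partition_number (cartesian_product G H) =
      min (delta_partition_number G) (delta_partition_number H)"
    unfolding delta_partition_number_def
  proof (rule Least_eq_min_Least[of _ _ _ "card (pverts G)" "card (pverts H)"], goal_cases)
    \<comment> \<open>Here the disjointness implications in \<open>factor\<close>,
      \<open>lift_fst\<close> and \<open>lift_snd\<close> come into play.\<close>
    case 1 then show ?case unfolding delta_convex_partition_def using factor by meson
  next
    case 2 then show ?case unfolding delta_convex_partition_def using lift_fst by meson
  next
    case 3 then show ?case unfolding delta_convex_partition_def using lift_snd by meson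
  next
    case 4 then show ?case using singletons(1) assms(3) by blast
  next
    case 5 then show ?case using singletons(2) assms(6) by blast
  qed
qed

end
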